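(* Let $S_{\boldsymbol\lambda}$ be a weighted shift on a directed tree $\mathcal{T}=(V,E)$ with weights $\boldsymbol\lambda=\{\lambda_v\}_{v\in V^\circ}\subseteq\mathbb{C}$. Then the following assertions hold for any $n\in\mathbb{Z}_+$. (i) A function $f\colon V\to\mathbb{C}$ belongs to $\mathcal{D}(S_{\boldsymbol\lambda}^n)$ if and only if $$\sum_{u\in V}|f(u)|^2\Big(\sum_{j=0}^n\ \sum_{v\in\mathrm{Chi}^{\langle j\rangle}(u)}|\lambda_{u\mid v}|^2\Big)<\infty,$$ with the usual convention that $0\cdot\infty=0$. (ii) If $f\in\mathcal{D}(S_{\boldsymbol\lambda}^n)$, then $e_u\in\mathcal{D}(S_{\boldsymbol\lambda}^n)$ for every $u\in V$ such that $f(u)\ne0$, and $$S_{\boldsymbol\lambda}^nf=\sum_{u\in V\colon f(u)\ne0}f(u)\,S_{\boldsymbol\lambda}^ne_u,\qquad \|S_{\boldsymbol\lambda}^nf\|^2=\sum_{u\in V\colon f(u)\ne0}|f(u)|^2\,\|S_{\boldsymbol\lambda}^ne_u\|^2,$$ where the terms of the first series are mutually orthogonal. (iii) If $\mathscr{E}_V\subseteq\mathcal{D}(S_{\boldsymbol\lambda}^n)$, then $\mathscr{E}_V$ is a core of $S_{\boldsymbol\lambda}^n$. (iv) $S_{\boldsymbol\lambda}^n$ is densely defined if and only if $\mathscr{E}_V\subseteq\mathcal{D}(S_{\boldsymbol\lambda}^n)$.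
   Context: $\mathbb{Z}_+=\{0,1,2,\ldots\}$. A directed tree $\mathcal{T}=(V,E)$ is a nonempty directed graph (vertices $V$, edges $E\subseteq V\times V$) which is connected (as an undirected graph), has no circuits, and in which each vertex $v$ has at most one $u$ with $(u,v)\in E$; this $u$ is denoted $\mathrm{par}(v)$. A vertex with no parent is called the root (there is at most one). $V^\circ=V\setminus\{\text{root}\}$ if there is a root and $V^\circ=V$ otherwise. $\mathrm{Chi}(u)=\{v\in V\colon(u,v)\in E\}$, $\mathrm{Chi}(W)=\bigcup_{v\in W}\mathrm{Chi}(v)$, $\mathrm{Chi}^{\langle0\rangle}(u)=\{u\}$, $\mathrm{Chi}^{\langle n+1\rangle}(u)=\mathrm{Chi}(\mathrm{Chi}^{\langle n\rangle}(u))$. $\ell^2(V)$ is the complex Hilbert space of square summable complex functions on $V$; $e_u$ is the characteristic function of $\{u\}$; $\mathscr{E}_V$ is the linear span of $\{e_u\colon u\in V\}$. The weighted shift $S_{\boldsymbol\lambda}$ is the operator in $\ell^2(V)$ with $\mathcal{D}(S_{\boldsymbol\lambda})=\{f\in\ell^2(V)\colon\Lambda f\in\ell^2(V)\}$, $S_{\boldsymbol\lambda}f=\Lambda f$, where $(\Lambda f)(v)=\lambda_vf(\mathrm{par}(v))$ for $v\in V^\circ$ and $(\Lambda f)(v)=0$ if $v$ is the root. $\lambda_{u\mid v}=1$ if $v=u$, and $\lambda_{u\mid v}=\prod_{j=0}^{n-1}\lambda_{\mathrm{par}^j(v)}$ if $v\in\mathrm{Chi}^{\langle n\rangle}(u)$,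 $n\ge1$ ($\mathrm{par}^j$ the $j$-fold composition of $\mathrm{par}$). Sums over the empty set are $0$. A linear subspace $\mathcal{E}\subseteq\mathcal{D}(A)$ is a core of an operator $A$ if the graph of $A$ is contained in the closure of the graph of $A|_{\mathcal{E}}$. *)

theory Defs
  imports "HOL-Analysis.Analysis" "HOL-Library.Function_Algebras"
begin

section \<open>Directed trees\<close>

text \<open>Acyclicity excludes loops as well as longer circuits.\<close>

locale directed_tree =
  fixes V :: "'a set" and E :: "('a \<times> 'a) set"
  assumes nonempty: "V \<noteq> {}"
    and edges: "E \<subseteq> V \<times> V"
    and connected: "\<And>u v. u \<in> V \<Longrightarrow> v \<in> V \<Longrightarrow> (u, v) \<in> (E \<union> E\<inverse>)\<^sup>*"
    and no_circuits: "acyclic E"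
    and parent_unique: "\<And>u u' v. (u, v) \<in> E \<Longrightarrow> (u', v) \<in> E \<Longrightarrow> u = u'"

definition par :: "('a \<times> 'a) set \<Rightarrow> 'a \<Rightarrow> 'a" where
  "par E v = (THE u. (u, v) \<in> E)"

definition roots :: "'a set \<Rightarrow> ('a \<times> 'a) set \<Rightarrow> 'a set" where
  "roots V E = {v \<in> V. \<not> (\<exists>u. (u, v) \<in> E)}"

definition nonroots :: "'a set \<Rightarrow> ('a \<times> 'a) set \<Rightarrow> 'a set" where
  "nonroots V E = V - roots V E"

text \<open>The image \<open>E `` W\<close> is the set of children of vertices in \<open>W\<close>.\<close>

primrec chi :: "('a \<times> 'a) set \<Rightarrow> nat \<Rightarrow> 'a \<Rightarrow> 'a set" where
  "chi E 0 u = {u}"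
| "chi E (Suc n) u = E `` chi E n u"

definition path_weight :: "('a \<times> 'a) set \<Rightarrow> ('a \<Rightarrow> complex) \<Rightarrow> 'a \<Rightarrow> 'a \<Rightarrow> complex" where
  "path_weight E lam u v =
     (if v = u then 1
      else (\<Prod>j<(THE n. 1 \<le> n \<and> v \<in> chi E n u). lam ((par E ^^ j) v)))"

text \<open>In a directed tree the generation number above is unique, so the definition
  yields the intended product in every generation.\<close>

context directed_tree
begin

lemma par_eq: "(u, v) \<in> E \<Longrightarrow> par E v = u"
  unfolding par_def using parent_unique by blast

lemma chi_relpow: "chi E n u = (E ^^ n) `` {u}"
  by (induction n) auto

lemma chi_par: "v \<in> chi E n u \<Longrightarrow> (par E ^^ n) v = u"
  by (induction n arbitrary: v) (auto simp: funpow_swap1 par_eq)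

lemma chi_unique_less:
  assumes "v \<in> chi E n u" "v \<in> chi E (n + k) u"
  shows "k = 0"
  using assms
proof (induction n arbitrary: v)
  case 0
  then have "(u, u) \<in> E ^^ k" by (auto simp: chi_relpow)
  then show ?case
    using no_circuits by (metis acyclic_def neq0_conv trancl_power)
next
  case (Suc n)
  then show ?case by (auto dest: parent_unique)
qed

lemma chi_unique: "v \<in> chi E n u \<Longrightarrow> v \<in> chi E m u \<Longrightarrow> n = m"
  by (metis chi_unique_less le_add_diff_inverse nat_le_linear add.right_neutral)

lemma path_weight_chi:
  assumes "v \<in> chi E n u"
  shows "path_weight E lam u v = (\<Prod>j<n. lam ((par E ^^ j) v))"
proof (cases "v = u")
  case True
  then have "n = 0" using assms chi_unique[of v n u 0] by auto
  then show ?thesis using True by (simp add: path_weight_def)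
next
  case False
  then have "1 \<le> n" using assms by (cases n) auto
  then have "(THE n. 1 \<le> n \<and> v \<in> chi E n u) = n"
    using assms chi_unique by blast
  then show ?thesis using False by (simp add: path_weight_def)
qed

end

section \<open>The Hilbert space of square summable functions\<close>

text \<open>A complex function on \<open>V\<close> is represented by its extension by zero.\<close>

definition cfuns :: "'a set \<Rightarrow> ('a \<Rightarrow> complex) set" where
  "cfuns V = {f. \<forall>v. v \<notin> V \<longrightarrow> f v = 0}"

definition ell2 :: "'a set \<Rightarrow> ('a \<Rightarrow> complex) set" where
  "ell2 V = {f \<in> cfuns V. (\<lambda>v. (cmod (f v))\<^sup>2) summable_on V}"

definition ell2_inner :: "'a set \<Rightarrow> ('a \<Rightarrow> complex) \<Rightarrow> ('a \<Rightarrow> complex) \<Rightarrow> complex" where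
  "ell2_inner V f g = (\<Sum>\<^sub>\<infinity>v\<in>V. f v * cnj (g v))"

definition ell2_norm :: "'a set \<Rightarrow> ('a \<Rightarrow> complex) \<Rightarrow> real" where
  "ell2_norm V f = sqrt (\<Sum>\<^sub>\<infinity>v\<in>V. (cmod (f v))\<^sup>2)"

definition ell2_dist :: "'a set \<Rightarrow> ('a \<Rightarrow> complex) \<Rightarrow> ('a \<Rightarrow> complex) \<Rightarrow> real" where
  "ell2_dist V f g = ell2_norm V (f - g)"

definition cscale :: "complex \<Rightarrow> ('a \<Rightarrow> complex) \<Rightarrow> 'a \<Rightarrow> complex" where
  "cscale c f = (\<lambda>v. c * f v)"

global_interpretation cfun: vector_space cscale
  by standard (auto simp: cscale_def algebra_simps fun_eq_iff)

lemma ell2_add_norm_le: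
  assumes "f \<in> ell2 V" "g \<in> ell2 V"
  shows "f + g \<in> ell2 V" "ell2_norm V (f + g) \<le> ell2_norm V f + ell2_norm V g"
proof -
  let ?B = "(ell2_norm V f + ell2_norm V g)\<^sup>2"
  have sf: "(\<lambda>v. (cmod (f v))\<^sup>2) summable_on V" and sg: "(\<lambda>v. (cmod (g v))\<^sup>2) summable_on V"
    using assms by (auto simp: ell2_def)
  have part: "L2_set (\<lambda>v. cmod (h v)) F \<le> ell2_norm V h"
    if "finite F" "F \<subseteq> V" "(\<lambda>v. (cmod (h v))\<^sup>2) summable_on V" for F h
    unfolding L2_set_def ell2_norm_def
    using that by (intro real_sqrt_le_mono finite_sum_le_infsum) auto
  have bound: "(\<Sum>v\<in>F. (cmod ((f + g) v))\<^sup>2) \<le> ?B" if "finite F" "F \<subseteq> V" for F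
  proof -
    have "L2_set (\<lambda>v. cmod ((f + g) v)) F \<le> L2_set (\<lambda>v. cmod (f v) + cmod (g v)) F"
      by (rule L2_set_mono) (auto simp: norm_triangle_ineq)
    also have "\<dots> \<le> L2_set (\<lambda>v. cmod (f v)) F + L2_set (\<lambda>v. cmod (g v)) F"
      by (rule L2_set_triangle_ineq)
    also have "\<dots> \<le> ell2_norm V f + ell2_norm V g"
      using part[OF that sf] part[OF that sg] by linarith
    finally have "(L2_set (\<lambda>v. cmod ((f + g) v)) F)\<^sup>2 \<le> ?B"
      by (rule power_mono) (rule L2_set_nonneg)
    then show ?thesis by (simp add: L2_set_def sum_nonneg)
  qed
  have s: "(\<lambda>v. (cmod ((f + g) v))\<^sup>2) summable_on V"
    by (rule nonneg_bdd_above_summable_on) (auto intro!: bdd_aboveI2[of _ _ ?B] bound[simplified])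
  show "f + g \<in> ell2 V"
    using assms s by (auto simp: ell2_def cfuns_def)
  have "(\<Sum>\<^sub>\<infinity>v\<in>V. (cmod ((f + g) v))\<^sup>2) \<le> ?B"
    using s bound by (rule infsum_le_finite_sums)
  moreover have "0 \<le> ell2_norm V f + ell2_norm V g"
    by (simp add: ell2_norm_def infsum_nonneg)
  ultimately show "ell2_norm V (f + g) \<le> ell2_norm V f + ell2_norm V g"
    unfolding ell2_norm_def[of V "f + g"] by (rule real_le_lsqrt[rotated])
qed

lemma ell2_norm_eq_0_iff:
  assumes "f \<in> ell2 V"
  shows "ell2_norm V f = 0 \<longleftrightarrow> f = 0"
proof
  assume "ell2_norm V f = 0"
  then have "(cmod (f v))\<^sup>2 = 0" if "v \<in> V" for v
    using assms that
    by (intro nonneg_infsum_le_0D[where A = V and f = "\<lambda>v. (cmod (f v))\<^sup>2"])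
       (auto simp: ell2_norm_def ell2_def)
  then show "f = 0"
    using assms by (fastforce simp: fun_eq_iff ell2_def cfuns_def)
qed (simp add: ell2_norm_def)

lemma ell2_cscale: "f \<in> ell2 V \<Longrightarrow> cscale c f \<in> ell2 V"
  by (auto simp: ell2_def cfuns_def cscale_def norm_mult power_mult_distrib
      intro!: summable_on_cmult_right)

lemma ell2_diff:
  assumes "f \<in> ell2 V" "g \<in> ell2 V"
  shows "f - g \<in> ell2 V"
proof -
  have "f + cscale (- 1) g \<in> ell2 V"
    using assms by (intro ell2_add_norm_le ell2_cscale)
  also have "f + cscale (- 1) g = f - g"
    by (auto simp: cscale_def)
  finally show ?thesis .
qed

global_interpretation ell2: Metric_space "ell2 V" "ell2_dist V" for V :: "'a set"
proof
  fix f g h :: "'a \<Rightarrow> complex"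
  show "0 \<le> ell2_dist V f g"
    by (simp add: ell2_dist_def ell2_norm_def infsum_nonneg)
  show "ell2_dist V f g = ell2_dist V g f"
    by (simp add: ell2_dist_def ell2_norm_def norm_minus_commute)
  assume fg: "f \<in> ell2 V" "g \<in> ell2 V"
  then show "ell2_dist V f g = 0 \<longleftrightarrow> f = g"
    by (simp add: ell2_dist_def ell2_norm_eq_0_iff ell2_diff)
  assume "h \<in> ell2 V"
  then show "ell2_dist V f h \<le> ell2_dist V f g + ell2_dist V g h"
    using ell2_add_norm_le(2)[OF ell2_diff[OF fg] ell2_diff[of g V h]] fg
    by (simp add: ell2_dist_def)
qed

abbreviation ell2_topology :: "'a set \<Rightarrow> ('a \<Rightarrow> complex) topology" where
  "ell2_topology V \<equiv> Metric_space.mtopology (ell2 V) (ell2_dist V)"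

definition unit_fun :: "'a \<Rightarrow> 'a \<Rightarrow> complex" where
  "unit_fun u = indicator {u}"

definition unit_span :: "'a set \<Rightarrow> ('a \<Rightarrow> complex) set" where
  "unit_span V = cfun.span (unit_fun ` V)"

section \<open>Operators\<close>

text \<open>An unbounded operator is a partial function \<open>A\<close>: its domain is \<open>dom A\<close>,
  its value at \<open>f\<close> in the domain is \<open>the (A f)\<close>, and its graph is \<open>Map.graph A\<close>.
  The composition \<open>\<circ>\<^sub>m\<close> of partial functions then carries the maximal domain.\<close>

type_synonym 'a operator = "('a \<Rightarrow> complex) \<rightharpoonup> ('a \<Rightarrow> complex)"

primrec op_power :: "'a set \<Rightarrow> 'a operator \<Rightarrow> nat \<Rightarrow> 'a operator" where
  "op_power V A 0 = Some |` ell2 V"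
| "op_power V A (Suc n) = A \<circ>\<^sub>m op_power V A n"

definition densely_defined :: "'a set \<Rightarrow> 'a operator \<Rightarrow> bool" where
  "densely_defined V A \<longleftrightarrow> ell2_topology V closure_of dom A = ell2 V"

definition is_core :: "'a set \<Rightarrow> 'a operator \<Rightarrow> ('a \<Rightarrow> complex) set \<Rightarrow> bool" where
  "is_core V A D \<longleftrightarrow>
     cfun.subspace D \<and> D \<subseteq> dom A \<and>
     Map.graph A \<subseteq>
       prod_topology (ell2_topology V) (ell2_topology V) closure_of Map.graph (A |` D)"

definition shift_map ::
  "'a set \<Rightarrow> ('a \<times> 'a) set \<Rightarrow> ('a \<Rightarrow> complex) \<Rightarrow> ('a \<Rightarrow> complex) \<Rightarrow> 'a \<Rightarrow> complex" where
  "shift_map V E lam f = (\<lambda>v. if v \<in> nonroots V E then lam v * f (par E v) else 0)"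

definition weighted_shift ::
  "'a set \<Rightarrow> ('a \<times> 'a) set \<Rightarrow> ('a \<Rightarrow> complex) \<Rightarrow> 'a operator" where
  "weighted_shift V E lam =
     (\<lambda>f. Some (shift_map V E lam f)) |` {f \<in> ell2 V. shift_map V E lam f \<in> ell2 V}"

end

theory Submission
  imports Defs
begin

text \<open>Each generation partitions the vertices that have an ancestor that far back:
  \<open>S\<^sup>j f\<close> takes the value \<open>\<lambda>\<^bsub>u|v\<^esub> f u\<close> at \<open>v \<in> Chi\<^sup>j u\<close>
  and vanishes elsewhere. Summing squared moduli in extended nonnegative reals therefore gives
  \<open>\<parallel>S\<^sup>j f\<parallel>\<^sup>2\<close> as the sum of \<open>|f u|\<^sup>2 \<parallel>S\<^sup>j e\<^sub>u\<parallel>\<^sup>2\<close> over \<open>u\<close>, with no convergence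
  issue, which is both the domain criterion and the norm formula. Applied to \<open>f\<close> minus its
  truncation to a finite set, it says that \<open>\<parallel>S\<^sup>j (f - f\<^sub>F)\<parallel>\<^sup>2\<close> is the tail of a convergent
  series. Taking \<open>j = n\<close> gives the orthogonal expansion, \<open>j = 0\<close> the density of the finitely
  supported functions, and both together the core property.\<close>

section \<open>Sums in the extended nonnegative reals\<close>

text \<open>The library's \<open>summable_on_ennreal\<close> only covers functions of the form
  \<open>ennreal_of_enat \<circ> f\<close>, because a coercion was inserted in its statement.\<close>

lemma ennreal_summable_on [simp]: "(f :: 'b \<Rightarrow> ennreal) summable_on A"
  by (simp add: nonneg_summable_on_complete)

lemma has_sum_ennreal_iff:
  fixes a :: "'b \<Rightarrow> real"
  assumes "\<And>x. x \<in> A \<Longrightarrow> 0 \<le> a x" "0 \<le> c"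
  shows "((\<lambda>x. ennreal (a x)) has_sum ennreal c) A \<longleftrightarrow> (a has_sum c) A"
proof -
  have ev: "\<forall>\<^sub>F F in finite_subsets_at_top A. sum (\<lambda>x. ennreal (a x)) F = ennreal (sum a F) \<and> 0 \<le> sum a F"
    using assms by (intro eventually_finite_subsets_at_top_weakI) (auto intro!: sum_nonneg sum_ennreal)
  have "((\<lambda>x. ennreal (a x)) has_sum ennreal c) A
      \<longleftrightarrow> ((\<lambda>F. ennreal (sum a F)) \<longlongrightarrow> ennreal c) (finite_subsets_at_top A)"
    unfolding has_sum_def by (rule tendsto_cong) (use ev in \<open>auto elim: eventually_mono\<close>)
  also have "\<dots> \<longleftrightarrow> (a has_sum c) A"
    unfolding has_sum_def using ev assms(2) by (intro tendsto_ennreal_iff) (auto elim: eventually_mono)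
  finally show ?thesis .
qed

text \<open>The way back from identities in \<open>ennreal\<close> to real sums: every family in
  \<open>ennreal\<close> is summable, and on nonnegative reals \<open>ennreal\<close> preserves and
  reflects limits of partial sums.\<close>

lemma infsum_ennreal_eq_iff:
  fixes a :: "'b \<Rightarrow> real"
  assumes "\<And>x. x \<in> A \<Longrightarrow> 0 \<le> a x" "0 \<le> c"
  shows "(\<Sum>\<^sub>\<infinity>x\<in>A. ennreal (a x)) = ennreal c \<longleftrightarrow> (a has_sum c) A"
proof -
  have "infsum h A = s \<longleftrightarrow> (h has_sum s) A" for h :: "'b \<Rightarrow> ennreal" and s
    using has_sum_infsum[OF ennreal_summable_on, of h A] infsumI by blast
  then show ?thesis using has_sum_ennreal_iff[of A a c] assms by simp
qed

lemma infsum_ennreal_finite_iff: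
  fixes a :: "'b \<Rightarrow> real"
  assumes "\<And>x. x \<in> A \<Longrightarrow> 0 \<le> a x"
  shows "(\<Sum>\<^sub>\<infinity>x\<in>A. ennreal (a x)) < \<infinity> \<longleftrightarrow> a summable_on A"
proof
  assume "(\<Sum>\<^sub>\<infinity>x\<in>A. ennreal (a x)) < \<infinity>"
  then obtain c where c: "0 \<le> c" "(\<Sum>\<^sub>\<infinity>x\<in>A. ennreal (a x)) = ennreal c"
    by (cases "\<Sum>\<^sub>\<infinity>x\<in>A. ennreal (a x)") auto
  then have "(a has_sum c) A"
    using infsum_ennreal_eq_iff[of A a c] assms by simp
  then show "a summable_on A" by (rule has_sum_imp_summable)
next
  assume "a summable_on A"
  then have "(a has_sum infsum a A) A" by simp
  then have "(\<Sum>\<^sub>\<infinity>x\<in>A. ennreal (a x)) = ennreal (infsum a A)"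
    using infsum_ennreal_eq_iff[of A a] assms by (simp add: infsum_nonneg)
  then show "(\<Sum>\<^sub>\<infinity>x\<in>A. ennreal (a x)) < \<infinity>" by simp
qed

lemma infsum_cmult_ennreal:
  fixes f :: "'b \<Rightarrow> ennreal"
  shows "(\<Sum>\<^sub>\<infinity>x\<in>A. c * f x) = c * infsum f A"
proof -
  have "{} \<in> {F. finite F \<and> F \<subseteq> A}" by simp
  then show ?thesis
    by (simp add: nonneg_infsum_complete SUP_mult_left_ennreal sum_distrib_left)
qed

lemma sum_infsum_ennreal:
  fixes f :: "'b \<Rightarrow> 'c \<Rightarrow> ennreal"
  assumes "finite J"
  shows "(\<Sum>j\<in>J. infsum (f j) A) = (\<Sum>\<^sub>\<infinity>x\<in>A. \<Sum>j\<in>J. f j x)"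
  using assms by induction (simp_all add: infsum_add)

lemma infsum_le_ennreal:
  fixes f :: "'b \<Rightarrow> ennreal"
  assumes "x \<in> A"
  shows "f x \<le> infsum f A"
  using infsum_mono_neutral[of f "{x}" f A] assms by simp

text \<open>Both sides are suprema of finite sums. A finite subset of the union is covered by
  finitely many blocks, and finitely many disjoint blocks add up by induction.\<close>

lemma infsum_UN_disjoint_ennreal:
  fixes f :: "'c \<Rightarrow> ennreal"
  assumes disj: "disjoint_family_on B A"
  shows "infsum f (\<Union>x\<in>A. B x) = (\<Sum>\<^sub>\<infinity>x\<in>A. infsum f (B x))" (is "?l = ?r")
proof (rule antisym)
  have "sum f F \<le> ?r" if F: "finite F" "F \<subseteq> (\<Union>x\<in>A. B x)" for F
  proof -
    have "\<forall>y\<in>F. \<exists>x. x \<in> A \<and> y \<in> B x" using F(2) by blast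
    \<comment> \<open>\<open>w\<close> assigns to each point of \<open>F\<close> a block containing
      it, so \<open>G\<close> below is a finite set of blocks covering \<open>F\<close>.\<close>
    from bchoice[OF this] obtain w where w: "\<forall>y\<in>F. w y \<in> A \<and> y \<in> B (w y)" ..
    define G where "G = w ` F"
    have G: "finite G" "G \<subseteq> A" "F \<subseteq> (\<Union>x\<in>G. B x)"
      using F(1) w by (auto simp: G_def)
    have "sum f F = sum f (\<Union>x\<in>G. F \<inter> B x)"
      using G by (intro sum.cong) auto
    also have "\<dots> = (\<Sum>x\<in>G. sum f (F \<inter> B x))"
    proof (intro sum.UNION_disjoint ballI impI)
      fix x y assume "x \<in> G" "y \<in> G" "x \<noteq> y"
      then have "B x \<inter> B y = {}"
        using disjoint_family_onD[OF disj] G(2) by blast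
      then show "(F \<inter> B x) \<inter> (F \<inter> B y) = {}" by blast
    qed (use F(1) G(1) in auto)
    also have "\<dots> = (\<Sum>x\<in>G. infsum f (F \<inter> B x))"
      using F by simp
    also have "\<dots> \<le> (\<Sum>x\<in>G. infsum f (B x))"
      by (intro sum_mono infsum_mono_neutral) auto
    also have "\<dots> = infsum (\<lambda>x. infsum f (B x)) G"
      using G by simp
    also have "\<dots> \<le> ?r"
      using G by (intro infsum_mono_neutral) auto
    finally show ?thesis .
  qed
  then show "?l \<le> ?r"
    by (auto simp: nonneg_infsum_complete[of "\<Union>x\<in>A. B x"] intro!: SUP_least)
next
  have "(\<Sum>x\<in>G. infsum f (B x)) \<le> ?l" if G: "finite G" "G \<subseteq> A" for G
  proof -
    have "(\<Sum>x\<in>G. infsum f (B x)) = infsum f (\<Union>x\<in>G. B x)"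
      using G
    proof induction
      case (insert x G)
      then have "B x \<inter> (\<Union>y\<in>G. B y) = {}"
        using disjoint_family_onD[OF disj, of x] by blast
      then show ?case
        using insert by (simp add: infsum_Un_disjoint)
    qed simp
    also have "\<dots> \<le> ?l"
      using G by (intro infsum_mono_neutral) auto
    finally show ?thesis .
  qed
  then show "?r \<le> ?l"
    by (auto simp: nonneg_infsum_complete[of A] intro!: SUP_least)
qed

section \<open>Square summable functions\<close>

text \<open>The squared norm with infinity allowed. In contrast, \<open>ell2_norm\<close> takes the
  default value 0 when the squares are not summable.\<close>

definition ell2_mass :: "'a set \<Rightarrow> ('a \<Rightarrow> complex) \<Rightarrow> ennreal" where
  "ell2_mass V f = (\<Sum>\<^sub>\<infinity>v\<in>V. ennreal ((cmod (f v))\<^sup>2))"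

lemma ell2_iff_mass: "f \<in> ell2 V \<longleftrightarrow> f \<in> cfuns V \<and> ell2_mass V f < \<infinity>"
  unfolding ell2_def ell2_mass_def by (subst infsum_ennreal_finite_iff) auto

lemma ell2_mass_eq:
  assumes "f \<in> ell2 V"
  shows "ell2_mass V f = ennreal ((ell2_norm V f)\<^sup>2)"
  unfolding ell2_mass_def using assms
  by (subst infsum_ennreal_eq_iff) (auto simp: ell2_norm_def ell2_def infsum_nonneg)

lemma ell2_norm_nonneg: "0 \<le> ell2_norm V f"
  by (simp add: ell2_norm_def infsum_nonneg)

text \<open>A single term is at most the whole sum. This serves to show that a function close to
  \<open>unit_fun u\<close> does not vanish at \<open>u\<close>.\<close>

lemma cmod_le_ell2_norm:
  assumes "f \<in> ell2 V" "v \<in> V"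
  shows "cmod (f v) \<le> ell2_norm V f"
proof -
  have "ennreal ((cmod (f v))\<^sup>2) \<le> ennreal ((ell2_norm V f)\<^sup>2)"
    using infsum_le_ennreal[OF assms(2)] ell2_mass_eq[OF assms(1)] by (metis ell2_mass_def)
  then show ?thesis
    by (simp add: power2_le_iff_abs_le ell2_norm_nonneg)
qed

lemma cfuns_unit_fun: "u \<in> V \<Longrightarrow> unit_fun u \<in> cfuns V"
  by (auto simp: cfuns_def unit_fun_def indicator_def)

lemma ell2_unit_fun:
  assumes "u \<in> V"
  shows "unit_fun u \<in> ell2 V"
proof -
  have "ell2_mass V (unit_fun u) = infsum (\<lambda>v. ennreal ((cmod (unit_fun u v))\<^sup>2)) {u}"
    unfolding ell2_mass_def using assms
    by (intro infsum_cong_neutral) (auto simp: unit_fun_def indicator_def)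
  then show ?thesis
    using assms by (simp add: ell2_iff_mass cfuns_unit_fun)
qed

text \<open>Stated for filters because the approximating truncations are indexed by finite sets of
  vertices.\<close>

lemma limitin_imp_in_closure_of:
  assumes "limitin X g x F" "F \<noteq> bot" "\<forall>\<^sub>F i in F. g i \<in> S"
  shows "x \<in> X closure_of S"
  unfolding in_closure_of
proof (intro conjI allI impI)
  show "x \<in> topspace X" using assms(1) by (simp add: limitin_def)
  fix U assume "x \<in> U \<and> openin X U"
  then have "\<forall>\<^sub>F i in F. g i \<in> U" using assms(1) by (simp add: limitin_def)
  with assms(3) have "\<forall>\<^sub>F i in F. g i \<in> S \<and> g i \<in> U" by (rule eventually_conj)
  then show "\<exists>y. y \<in> S \<and> y \<in> U" using assms(2) eventually_happens' by blast
qed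

section \<open>Powers of a weighted shift\<close>

lemma shift_map_add: "shift_map V E lam (f + g) = shift_map V E lam f + shift_map V E lam g"
  by (auto simp: shift_map_def algebra_simps fun_eq_iff)

lemma shift_map_cscale: "shift_map V E lam (cscale c f) = cscale c (shift_map V E lam f)"
  by (auto simp: shift_map_def cscale_def fun_eq_iff)

lemma shift_funpow_add:
  "(shift_map V E lam ^^ j) (f + g) = (shift_map V E lam ^^ j) f + (shift_map V E lam ^^ j) g"
  by (induction j) (simp_all only: funpow.simps o_apply id_apply shift_map_add)

lemma shift_funpow_cscale:
  "(shift_map V E lam ^^ j) (cscale c f) = cscale c ((shift_map V E lam ^^ j) f)"
  by (induction j) (simp_all only: funpow.simps o_apply id_apply shift_map_cscale)

lemma shift_funpow_0: "(shift_map V E lam ^^ j) 0 = 0"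
  by (induction j) (auto simp: shift_map_def zero_fun_def)

lemma shift_funpow_sum:
  assumes "finite F"
  shows "(shift_map V E lam ^^ j) (\<Sum>u\<in>F. cscale (c u) (h u))
    = (\<Sum>u\<in>F. cscale (c u) ((shift_map V E lam ^^ j) (h u)))"
  using assms
proof induction
  case empty
  show ?case by (simp only: sum.empty shift_funpow_0)
next
  case (insert x F)
  then show ?case
    by (simp only: sum.insert[OF insert.hyps] shift_funpow_add shift_funpow_cscale)
qed

section \<open>Domains of the powers\<close>

definition shift_domain :: "'a set \<Rightarrow> ('a \<times> 'a) set \<Rightarrow> ('a \<Rightarrow> complex) \<Rightarrow> nat \<Rightarrow> ('a \<Rightarrow> complex) set" where
  "shift_domain V E lam n = {f. \<forall>j\<le>n. (shift_map V E lam ^^ j) f \<in> ell2 V}"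

text \<open>Composing partial maps asks at each stage that the next iterate be square summable
  again. The domain therefore constrains all iterates up to \<open>n\<close>, and
  \<open>j = 0\<close> places \<open>f\<close> itself in \<open>ell2 V\<close>.\<close>

lemma op_power_weighted_shift:
  "op_power V (weighted_shift V E lam) n
    = (\<lambda>f. Some ((shift_map V E lam ^^ n) f)) |` shift_domain V E lam n"
proof (induction n)
  case 0
  show ?case by (auto simp: fun_eq_iff restrict_map_def shift_domain_def)
next
  case (Suc n)
  have dom: "f \<in> shift_domain V E lam (Suc n) \<longleftrightarrow>
      f \<in> shift_domain V E lam n \<and> (shift_map V E lam ^^ Suc n) f \<in> ell2 V" for f
    by (auto simp: shift_domain_def le_Suc_eq simp del: funpow.simps)
  show ?case
  proof
    fix f
    show "op_power V (weighted_shift V E lam) (Suc n) f =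
        ((\<lambda>f. Some ((shift_map V E lam ^^ Suc n) f)) |` shift_domain V E lam (Suc n)) f"
      unfolding op_power.simps Suc.IH map_comp_def restrict_map_def dom
      by (auto simp: weighted_shift_def restrict_map_def shift_domain_def)
  qed
qed

lemma dom_op_power: "dom (op_power V (weighted_shift V E lam) n) = shift_domain V E lam n"
  by (auto simp: op_power_weighted_shift restrict_map_def dom_def)

lemma op_power_eq:
  "f \<in> shift_domain V E lam n \<Longrightarrow>
    op_power V (weighted_shift V E lam) n f = Some ((shift_map V E lam ^^ n) f)"
  by (simp add: op_power_weighted_shift)

lemma shift_domain_cfuns: "f \<in> shift_domain V E lam n \<Longrightarrow> f \<in> cfuns V"
  by (auto simp: shift_domain_def ell2_def dest: spec[of _ 0])

lemma subspace_shift_domain: "cfun.subspace (shift_domain V E lam n)"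
proof -
  have "0 \<in> ell2 V" by (simp add: ell2_def cfuns_def)
  then show ?thesis
    by (intro cfun.subspaceI)
      (auto simp: shift_domain_def shift_funpow_0 shift_funpow_add shift_funpow_cscale
        intro: ell2_add_norm_le(1) ell2_cscale)
qed

text \<open>For \<open>u\<close> in \<open>V\<close> this turns out to be the squared norm, possibly
  infinite, of the \<open>j\<close>-th iterate at \<open>unit_fun u\<close>.\<close>

definition generation_mass :: "('a \<times> 'a) set \<Rightarrow> ('a \<Rightarrow> complex) \<Rightarrow> nat \<Rightarrow> 'a \<Rightarrow> ennreal" where
  "generation_mass E lam j u = (\<Sum>\<^sub>\<infinity>v\<in>chi E j u. ennreal ((cmod (path_weight E lam u v))\<^sup>2))"

text \<open>Finite sets \<open>A\<close> give the approximations, their complements the remainders,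
  and singletons multiples of unit functions.\<close>

definition truncate :: "'a set \<Rightarrow> ('a \<Rightarrow> complex) \<Rightarrow> 'a \<Rightarrow> complex" where
  "truncate A f = (\<lambda>v. if v \<in> A then f v else 0)"

lemma cfuns_truncate: "f \<in> cfuns V \<Longrightarrow> truncate A f \<in> cfuns V"
  by (auto simp: cfuns_def truncate_def)

lemma truncate_finite_eq_sum:
  assumes "finite F"
  shows "truncate F f = (\<Sum>u\<in>F. cscale (f u) (unit_fun u))"
  using assms
proof induction
  case empty
  show ?case by (simp add: truncate_def zero_fun_def)
next
  case (insert x F)
  have "truncate (insert x F) f = cscale (f x) (unit_fun x) + truncate F f"
    using insert.hyps by (auto simp: truncate_def cscale_def unit_fun_def indicator_def fun_eq_iff)
  with insert show ?case by simp
qed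

section \<open>Iterates along generations\<close>

context directed_tree
begin

lemma chi_subset: "u \<in> V \<Longrightarrow> chi E j u \<subseteq> V"
  using edges by (cases j) auto

lemma disjoint_chi: "disjoint_family_on (chi E j) A"
  unfolding disjoint_family_on_def by (auto dest: chi_par)

text \<open>Each application of the shift reads the value at the parent and contributes one weight,
  so \<open>j\<close> applications collect the weights on the path down from
  \<open>u\<close>.\<close>

lemma shift_funpow_chi:
  assumes "v \<in> chi E j u"
  shows "(shift_map V E lam ^^ j) f v = path_weight E lam u v * f u"
  using assms
proof (induction j arbitrary: v)
  case 0
  then show ?case by (simp add: path_weight_def)
next
  case (Suc j)
  then obtain w where w: "w \<in> chi E j u" "(w, v) \<in> E" by auto
  then have v: "v \<in> nonroots V E" "par E v = w"
    using edges par_eq by (auto simp: nonroots_def roots_def)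
  \<comment> \<open>The factor with index 0 is \<open>lam v\<close>; the others, shifted by one, are
    the factors for the parent \<open>w\<close>.\<close>
  have "path_weight E lam u v = lam v * path_weight E lam u w"
    unfolding path_weight_chi[OF Suc.prems] path_weight_chi[OF w(1)] prod.lessThan_Suc_shift
    using v by (simp add: funpow_swap1)
  then show ?case
    using v Suc.IH[OF w(1)] by (simp add: shift_map_def)
qed

text \<open>For \<open>j = 0\<close> the point lies outside \<open>V\<close>, where \<open>f\<close>
  vanishes. Otherwise it runs out of ancestors in fewer than \<open>j\<close> steps, and there the
  shift writes 0.\<close>

lemma shift_funpow_outside:
  assumes "f \<in> cfuns V" "v \<notin> (\<Union>u\<in>V. chi E j u)"
  shows "(shift_map V E lam ^^ j) f v = 0"
  using assms(2)
proof (induction j arbitrary: v)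
  case 0
  then show ?case using assms(1) by (simp add: cfuns_def)
next
  case (Suc j)
  show ?case
  proof (cases "v \<in> nonroots V E")
    case True
    then obtain w where w: "(w, v) \<in> E" by (auto simp: nonroots_def roots_def)
    then have "w \<notin> (\<Union>u\<in>V. chi E j u)" using Suc.prems by auto
    then show ?thesis using Suc.IH par_eq[OF w] by (simp add: shift_map_def)
  qed (simp add: shift_map_def)
qed

lemma cfuns_shift_funpow:
  assumes "f \<in> cfuns V"
  shows "(shift_map V E lam ^^ j) f \<in> cfuns V"
  unfolding cfuns_def mem_Collect_eq
proof (intro allI impI shift_funpow_outside[OF assms])
  fix v assume "v \<notin> V"
  then show "v \<notin> (\<Union>u\<in>V. chi E j u)" using chi_subset by blast
qed

text \<open>The \<open>j\<close>-th generations are disjoint blocks carrying all nonzero values, and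
  \<open>f u\<close> factors out of the block of \<open>u\<close>. If \<open>f u = 0\<close>, the
  rule \<open>0 * \<infinity> = 0\<close> in \<open>ennreal\<close> is the convention of the
  theorem.\<close>

lemma ell2_mass_shift_funpow:
  assumes "f \<in> cfuns V"
  shows "ell2_mass V ((shift_map V E lam ^^ j) f)
    = (\<Sum>\<^sub>\<infinity>u\<in>V. ennreal ((cmod (f u))\<^sup>2) * generation_mass E lam j u)"
proof -
  let ?g = "\<lambda>v. ennreal ((cmod ((shift_map V E lam ^^ j) f v))\<^sup>2)"
  have "ell2_mass V ((shift_map V E lam ^^ j) f) = infsum ?g (\<Union>u\<in>V. chi E j u)"
    unfolding ell2_mass_def
  proof (rule infsum_cong_neutral)
    show "?g v = 0" if "v \<in> V - (\<Union>u\<in>V. chi E j u)" for v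
      using that shift_funpow_outside[OF assms] by simp
  qed (use chi_subset in blast)+
  also have "\<dots> = (\<Sum>\<^sub>\<infinity>u\<in>V. infsum ?g (chi E j u))"
    by (rule infsum_UN_disjoint_ennreal[OF disjoint_chi])
  also have "\<dots> = (\<Sum>\<^sub>\<infinity>u\<in>V. ennreal ((cmod (f u))\<^sup>2) * generation_mass E lam j u)"
    unfolding generation_mass_def infsum_cmult_ennreal[symmetric]
    by (intro infsum_cong)
      (simp add: shift_funpow_chi norm_mult power_mult_distrib ennreal_mult' mult.commute)
  finally show ?thesis .
qed

lemma ell2_mass_shift_funpow_unit_fun:
  assumes "u \<in> V"
  shows "ell2_mass V ((shift_map V E lam ^^ j) (unit_fun u)) = generation_mass E lam j u"
proof -
  have "ell2_mass V ((shift_map V E lam ^^ j) (unit_fun u))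
      = infsum (\<lambda>w. ennreal ((cmod (unit_fun u w))\<^sup>2) * generation_mass E lam j w) {u}"
    unfolding ell2_mass_shift_funpow[OF cfuns_unit_fun[OF assms]] using assms
    by (intro infsum_cong_neutral) (auto simp: unit_fun_def indicator_def)
  then show ?thesis by (simp add: unit_fun_def)
qed

section \<open>Domain criterion and norm formula\<close>

lemma shift_domain_iff_mass:
  assumes "f \<in> cfuns V"
  shows "f \<in> shift_domain V E lam n \<longleftrightarrow>
    (\<forall>j\<le>n. ell2_mass V ((shift_map V E lam ^^ j) f) < \<infinity>)"
  using assms by (simp add: shift_domain_def ell2_iff_mass cfuns_shift_funpow)

text \<open>A finite sum in \<open>ennreal\<close> is finite exactly when each summand is, so the
  conditions for all \<open>j \<le> n\<close> merge into one series.\<close>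

lemma shift_domain_iff:
  assumes "f \<in> cfuns V"
  shows "f \<in> shift_domain V E lam n \<longleftrightarrow>
    (\<Sum>\<^sub>\<infinity>u\<in>V. ennreal ((cmod (f u))\<^sup>2) * (\<Sum>j=0..n. generation_mass E lam j u)) < \<infinity>"
proof -
  have "(\<Sum>\<^sub>\<infinity>u\<in>V. ennreal ((cmod (f u))\<^sup>2) * (\<Sum>j=0..n. generation_mass E lam j u))
      = (\<Sum>j=0..n. ell2_mass V ((shift_map V E lam ^^ j) f))"
    by (simp add: ell2_mass_shift_funpow[OF assms] sum_infsum_ennreal sum_distrib_left)
  then show ?thesis
    by (auto simp: shift_domain_iff_mass[OF assms] less_top)
qed

text \<open>Every mass is a sum over \<open>u\<close> with nonnegative coefficients on
  \<open>(cmod (f u))\<^sup>2\<close>, so setting values to 0 cannot increase it.\<close>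

lemma truncate_in_shift_domain:
  assumes "f \<in> shift_domain V E lam n"
  shows "truncate A f \<in> shift_domain V E lam n"
proof -
  have f: "f \<in> cfuns V" using assms by (rule shift_domain_cfuns)
  have "ell2_mass V ((shift_map V E lam ^^ j) (truncate A f))
      \<le> ell2_mass V ((shift_map V E lam ^^ j) f)" for j
    unfolding ell2_mass_shift_funpow[OF f] ell2_mass_shift_funpow[OF cfuns_truncate[OF f]]
    by (intro infsum_mono) (auto simp: truncate_def)
  then show ?thesis
    using assms f by (auto simp: shift_domain_iff_mass cfuns_truncate intro: le_less_trans)
qed

text \<open>The domain contains the truncation of \<open>f\<close> to \<open>{u}\<close>, a nonzero
  multiple of \<open>unit_fun u\<close>.\<close>

lemma unit_fun_in_shift_domain:
  assumes "f \<in> shift_domain V E lam n" "f u \<noteq> 0"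
  shows "unit_fun u \<in> shift_domain V E lam n"
proof -
  have "unit_fun u = cscale (1 / f u) (truncate {u} f)"
    using assms(2) by (auto simp: unit_fun_def indicator_def cscale_def truncate_def fun_eq_iff)
  then show ?thesis
    using cfun.subspace_scale[OF subspace_shift_domain truncate_in_shift_domain[OF assms(1)]]
    by simp
qed

text \<open>Where \<open>f u \<noteq> 0\<close>, the iterates of \<open>unit_fun u\<close> lie in
  \<open>ell2 V\<close>, so their norms are genuine. The other vertices contribute 0 to the mass,
  even if their generation mass is infinite.\<close>

lemma has_sum_shift_funpow_norm:
  assumes f: "f \<in> shift_domain V E lam n" and j: "j \<le> n"
  shows "((\<lambda>u. (cmod (f u))\<^sup>2 * (ell2_norm V ((shift_map V E lam ^^ j) (unit_fun u)))\<^sup>2)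
    has_sum (ell2_norm V ((shift_map V E lam ^^ j) f))\<^sup>2) {u \<in> V. f u \<noteq> 0}"
proof -
  have "ennreal ((cmod (f u))\<^sup>2 * (ell2_norm V ((shift_map V E lam ^^ j) (unit_fun u)))\<^sup>2)
      = ennreal ((cmod (f u))\<^sup>2) * generation_mass E lam j u" if "u \<in> V" "f u \<noteq> 0" for u
  proof -
    have "(shift_map V E lam ^^ j) (unit_fun u) \<in> ell2 V"
      using unit_fun_in_shift_domain[OF f that(2)] j by (simp add: shift_domain_def)
    from ell2_mass_eq[OF this] show ?thesis
      using ell2_mass_shift_funpow_unit_fun[OF that(1)] by (simp add: ennreal_mult')
  qed
  then have "(\<Sum>\<^sub>\<infinity>u\<in>{u \<in> V. f u \<noteq> 0}. ennreal ((cmod (f u))\<^sup>2 *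
        (ell2_norm V ((shift_map V E lam ^^ j) (unit_fun u)))\<^sup>2))
      = (\<Sum>\<^sub>\<infinity>u\<in>V. ennreal ((cmod (f u))\<^sup>2) * generation_mass E lam j u)"
    by (intro infsum_cong_neutral) auto
  also have "\<dots> = ell2_mass V ((shift_map V E lam ^^ j) f)"
    using ell2_mass_shift_funpow[OF shift_domain_cfuns[OF f]] by simp
  also have "\<dots> = ennreal ((ell2_norm V ((shift_map V E lam ^^ j) f))\<^sup>2)"
    using f j by (intro ell2_mass_eq) (simp add: shift_domain_def)
  finally show ?thesis
    by (subst (asm) infsum_ennreal_eq_iff) auto
qed

text \<open>The error is the iterate of a remainder that is itself a truncation of \<open>f\<close>.
  By the norm formula its squared norm is the total minus a partial sum.\<close>

lemma limitin_shift_funpow_truncate: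
  assumes f: "f \<in> shift_domain V E lam n" and j: "j \<le> n"
  shows "limitin (ell2_topology V) (\<lambda>F. (shift_map V E lam ^^ j) (truncate F f))
    ((shift_map V E lam ^^ j) f) (finite_subsets_at_top {u \<in> V. f u \<noteq> 0})"
proof -
  let ?T = "shift_map V E lam ^^ j" and ?S = "{u \<in> V. f u \<noteq> 0}"
  let ?a = "\<lambda>u. (cmod (f u))\<^sup>2 * (ell2_norm V (?T (unit_fun u)))\<^sup>2"
  have dist: "ell2_dist V (?T (truncate F f)) (?T f) = sqrt ((ell2_norm V (?T f))\<^sup>2 - sum ?a F)"
    if F: "finite F" "F \<subseteq> ?S" for F
  proof -
    let ?h = "truncate (- F) f"
    have "f = truncate F f + ?h"
      by (auto simp: truncate_def fun_eq_iff)
    then have "?T f = ?T (truncate F f) + ?T ?h"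
      by (metis shift_funpow_add)
    then have "ell2_dist V (?T f) (?T (truncate F f)) = ell2_norm V (?T ?h)"
      by (simp add: ell2_dist_def)
    moreover have "(ell2_norm V (?T ?h))\<^sup>2 = (ell2_norm V (?T f))\<^sup>2 - sum ?a F"
    \<comment> \<open>Both numbers are sums of \<open>?a\<close> over \<open>?S - F\<close>: one by
      the norm formula for the remainder, the other by removing \<open>F\<close> from the full
      sum.\<close>
    proof (rule has_sum_unique)
      have S: "{u \<in> V. ?h u \<noteq> 0} = ?S - F" by (auto simp: truncate_def)
      show "(?a has_sum (ell2_norm V (?T ?h))\<^sup>2) (?S - F)"
        using has_sum_shift_funpow_norm[OF truncate_in_shift_domain[OF f] j, of "- F"]
        unfolding S by (rule has_sum_cong[THEN iffD1, rotated]) (auto simp: truncate_def)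
      show "(?a has_sum (ell2_norm V (?T f))\<^sup>2 - sum ?a F) (?S - F)"
        using F by (intro has_sum_Diff has_sum_shift_funpow_norm[OF f j] has_sum_finite) auto
    qed
    ultimately show ?thesis
      by (subst ell2.commute) (simp add: real_sqrt_unique ell2_norm_nonneg)
  qed
  have "(sum ?a \<longlongrightarrow> (ell2_norm V (?T f))\<^sup>2) (finite_subsets_at_top ?S)"
    using has_sum_shift_funpow_norm[OF f j] by (simp add: has_sum_def)
  then have "((\<lambda>F. sqrt ((ell2_norm V (?T f))\<^sup>2 - sum ?a F)) \<longlongrightarrow> sqrt ((ell2_norm V (?T f))\<^sup>2 - (ell2_norm V (?T f))\<^sup>2))
      (finite_subsets_at_top ?S)"
    by (intro tendsto_intros)
  then have "((\<lambda>F. ell2_dist V (?T (truncate F f)) (?T f)) \<longlongrightarrow> 0) (finite_subsets_at_top ?S)"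
    by (rule Lim_transform_eventually[THEN tendsto_eq_rhs])
      (auto simp: dist intro!: eventually_finite_subsets_at_top_weakI)
  moreover have "?T (truncate F f) \<in> ell2 V" for F
    using truncate_in_shift_domain[OF f] j by (simp add: shift_domain_def)
  moreover have "?T f \<in> ell2 V"
    using f j by (simp add: shift_domain_def)
  ultimately show ?thesis
    by (simp add: ell2.limitin_metric_dist_null)
qed

text \<open>The two functions have disjoint supports, namely within the \<open>j\<close>-th
  generations of distinct vertices.\<close>

lemma shift_funpow_unit_fun_orthogonal:
  assumes "u \<in> V" "u' \<in> V" "u \<noteq> u'"
  shows "ell2_inner V (cscale c ((shift_map V E lam ^^ j) (unit_fun u)))
    (cscale d ((shift_map V E lam ^^ j) (unit_fun u'))) = 0"
proof -
  \<comment> \<open>Off its own generation, \<open>v\<close> lies either in that of another vertex,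
    where \<open>unit_fun w\<close> is 0, or in none.\<close>
  have supp: "(shift_map V E lam ^^ j) (unit_fun w) v = 0"
    if "w \<in> V" "v \<notin> chi E j w" for w v
    using shift_funpow_chi[of v j _ lam "unit_fun w"] shift_funpow_outside[OF cfuns_unit_fun[OF that(1)]] that(2)
    by (cases "v \<in> (\<Union>u\<in>V. chi E j u)") (auto simp: unit_fun_def indicator_def)
  have "chi E j u \<inter> chi E j u' = {}"
    using disjoint_chi[of j UNIV] assms(3) by (simp add: disjoint_family_on_def)
  then have "(shift_map V E lam ^^ j) (unit_fun u) v = 0 \<or> (shift_map V E lam ^^ j) (unit_fun u') v = 0" for v
    using supp assms by blast
  then show ?thesis
    unfolding ell2_inner_def cscale_def by (intro infsum_0) auto
qed

section \<open>Core and density of the finitely supported functions\<close>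

lemma eventually_truncate_in_unit_span:
  "\<forall>\<^sub>F F in finite_subsets_at_top {u \<in> V. f u \<noteq> 0}. truncate F f \<in> unit_span V"
proof (rule eventually_finite_subsets_at_top_weakI)
  fix F assume F: "finite F" "F \<subseteq> {u \<in> V. f u \<noteq> 0}"
  have "cscale (f u) (unit_fun u) \<in> cfun.span (unit_fun ` V)" if "u \<in> F" for u
    using that F(2) by (intro cfun.span_scale) (auto intro: cfun.span_base)
  then show "truncate F f \<in> unit_span V"
    unfolding truncate_finite_eq_sum[OF F(1)] unit_span_def by (rule cfun.span_sum)
qed

text \<open>The same truncations converge to \<open>f\<close> (case \<open>j = 0\<close>) while
  their images converge to the image of \<open>f\<close> (case \<open>j = n\<close>), hence the
  pairs converge in the product topology.\<close>

lemma is_core_unit_span: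
  assumes "unit_span V \<subseteq> shift_domain V E lam n"
  shows "is_core V (op_power V (weighted_shift V E lam) n) (unit_span V)"
  unfolding is_core_def
proof (intro conjI subsetI)
  let ?A = "op_power V (weighted_shift V E lam) n" and ?T = "shift_map V E lam ^^ n"
  show "cfun.subspace (unit_span V)"
    by (simp add: unit_span_def cfun.subspace_span)
  show "f \<in> dom ?A" if "f \<in> unit_span V" for f
    using that assms by (auto simp: dom_op_power)
  fix p assume "p \<in> Map.graph ?A"
  then obtain f where f: "f \<in> shift_domain V E lam n" and p: "p = (f, ?T f)"
    using dom_op_power[of V E lam n]
    by (auto simp: graph_def op_power_weighted_shift restrict_map_def split: if_splits)
  let ?\<F> = "finite_subsets_at_top {u \<in> V. f u \<noteq> 0}"
  have "limitin (prod_topology (ell2_topology V) (ell2_topology V))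
      (\<lambda>F. (truncate F f, ?T (truncate F f))) p ?\<F>"
    unfolding limitin_pairwise p
    using limitin_shift_funpow_truncate[OF f, of 0] limitin_shift_funpow_truncate[OF f, of n]
    by (simp add: o_def)
  moreover have "\<forall>\<^sub>F F in ?\<F>. (truncate F f, ?T (truncate F f)) \<in> Map.graph (?A |` unit_span V)"
    using eventually_truncate_in_unit_span[of f]
    by (rule eventually_mono)
      (use truncate_in_shift_domain[OF f] in \<open>auto simp: graph_def restrict_map_def op_power_eq\<close>)
  ultimately show "p \<in> prod_topology (ell2_topology V) (ell2_topology V) closure_of Map.graph (?A |` unit_span V)"
    by (intro limitin_imp_in_closure_of) simp_all
qed

text \<open>This is convergence of truncations for the zeroth power, whose domain is
  \<open>ell2 V\<close> for any weights.\<close>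

lemma unit_span_dense: "ell2_topology V closure_of unit_span V = ell2 V"
proof
  show "ell2_topology V closure_of unit_span V \<subseteq> ell2 V"
    using closure_of_subset_topspace[of "ell2_topology V"] by simp
  show "ell2 V \<subseteq> ell2_topology V closure_of unit_span V"
  proof
    fix f assume "f \<in> ell2 V"
    then have "f \<in> shift_domain V E lam 0" for lam by (simp add: shift_domain_def)
    from limitin_shift_funpow_truncate[OF this, of 0]
    have "limitin (ell2_topology V) (\<lambda>F. truncate F f) f (finite_subsets_at_top {u \<in> V. f u \<noteq> 0})"
      by simp
    then show "f \<in> ell2_topology V closure_of unit_span V"
      by (rule limitin_imp_in_closure_of) (simp_all add: eventually_truncate_in_unit_span)
  qed
qed

text \<open>A dense domain has a member \<open>f\<close> at distance less than 1 from
  \<open>unit_fun u\<close>. Since \<open>unit_fun u\<close> is 1 at \<open>u\<close>,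
  \<open>f u\<close> is nonzero, which puts \<open>unit_fun u\<close> into the domain. The converse
  is density of the span.\<close>

lemma densely_defined_iff:
  "densely_defined V (op_power V (weighted_shift V E lam) n) \<longleftrightarrow>
    unit_span V \<subseteq> shift_domain V E lam n" (is "?dd \<longleftrightarrow> _")
proof
  assume dd: ?dd
  have "unit_fun u \<in> shift_domain V E lam n" if u: "u \<in> V" for u
  proof -
    have "unit_fun u \<in> ell2_topology V closure_of shift_domain V E lam n"
      using dd ell2_unit_fun[OF u] by (simp add: densely_defined_def dom_op_power)
    then have "\<exists>f\<in>shift_domain V E lam n. f \<in> ell2.mball V (unit_fun u) 1"
      by (simp only: ell2.metric_closure_of mem_Collect_eq zero_less_one)
    then obtain f where f: "f \<in> shift_domain V E lam n" "f \<in> ell2 V" "ell2_dist V (unit_fun u) f < 1"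
      unfolding ell2.in_mball by blast
    have "cmod ((unit_fun u - f) u) < 1"
      using cmod_le_ell2_norm[OF ell2_diff[OF ell2_unit_fun[OF u] f(2)] u] f(3)
      by (simp add: ell2_dist_def)
    then have "f u \<noteq> 0" by (auto simp: unit_fun_def indicator_def)
    with f(1) show ?thesis by (rule unit_fun_in_shift_domain)
  qed
  then show "unit_span V \<subseteq> shift_domain V E lam n"
    unfolding unit_span_def by (intro cfun.span_minimal subspace_shift_domain) auto
next
  assume "unit_span V \<subseteq> shift_domain V E lam n"
  from closure_of_mono[OF this, of "ell2_topology V"]
  show ?dd
    using closure_of_subset_topspace[of "ell2_topology V"]
    by (auto simp: densely_defined_def dom_op_power unit_span_dense)
qed

end

theorem theorem3p2p2:
  fixes V :: "'a set" and E :: "('a \<times> 'a) set" and lam :: "'a \<Rightarrow> complex" and n :: nat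
  assumes "directed_tree V E"
  defines "Sn \<equiv> op_power V (weighted_shift V E lam) n"
  shows
    "(\<forall>f \<in> cfuns V.
        f \<in> dom Sn \<longleftrightarrow>
        (\<Sum>\<^sub>\<infinity>u\<in>V. ennreal ((cmod (f u))\<^sup>2) *
           (\<Sum>j=0..n. \<Sum>\<^sub>\<infinity>v\<in>chi E j u. ennreal ((cmod (path_weight E lam u v))\<^sup>2))) < \<infinity>) \<and>
     (\<forall>f \<in> dom Sn.
        (\<forall>u\<in>V. f u \<noteq> 0 \<longrightarrow> unit_fun u \<in> dom Sn) \<and>
        limitin (ell2_topology V)
          (\<lambda>F. \<Sum>u\<in>F. cscale (f u) (the (Sn (unit_fun u)))) (the (Sn f))
          (finite_subsets_at_top {u \<in> V. f u \<noteq> 0}) \<and>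
        ((\<lambda>u. (cmod (f u))\<^sup>2 * (ell2_norm V (the (Sn (unit_fun u))))\<^sup>2)
          has_sum (ell2_norm V (the (Sn f)))\<^sup>2) {u \<in> V. f u \<noteq> 0} \<and>
        pairwise (\<lambda>u u'. ell2_inner V (cscale (f u) (the (Sn (unit_fun u))))
                                      (cscale (f u') (the (Sn (unit_fun u')))) = 0)
          {u \<in> V. f u \<noteq> 0}) \<and>
     (unit_span V \<subseteq> dom Sn \<longrightarrow> is_core V Sn (unit_span V)) \<and>
     (densely_defined V Sn \<longleftrightarrow> unit_span V \<subseteq> dom Sn)"
proof -
  interpret directed_tree V E by fact
  let ?D = "shift_domain V E lam n" and ?T = "shift_map V E lam ^^ n"
  have dom: "dom Sn = ?D" by (simp add: Sn_def dom_op_power)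
  have val: "the (Sn f) = ?T f" if "f \<in> ?D" for f
    using that by (simp add: Sn_def op_power_eq)
  have unit: "unit_fun u \<in> ?D" if "f \<in> ?D" "f u \<noteq> 0" for f u
    using that by (rule unit_fun_in_shift_domain)
  have "limitin (ell2_topology V)
      (\<lambda>F. \<Sum>u\<in>F. cscale (f u) (the (Sn (unit_fun u)))) (the (Sn f))
      (finite_subsets_at_top {u \<in> V. f u \<noteq> 0})" if f: "f \<in> ?D" for f
  proof -
    \<comment> \<open>By linearity the partial sums of the series are the images of truncations;
      \<open>f u \<noteq> 0\<close> on \<open>F\<close> ensures that \<open>the\<close> is applied
      to a defined value.\<close>
    have "?T (truncate F f) = (\<Sum>u\<in>F. cscale (f u) (the (Sn (unit_fun u))))"
      if F: "finite F" "F \<subseteq> {u \<in> V. f u \<noteq> 0}" for F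
      unfolding truncate_finite_eq_sum[OF F(1)] shift_funpow_sum[OF F(1)]
      using F(2) by (intro sum.cong refl) (auto simp: val unit[OF f])
    then have "\<forall>\<^sub>F F in finite_subsets_at_top {u \<in> V. f u \<noteq> 0}.
        ?T (truncate F f) = (\<Sum>u\<in>F. cscale (f u) (the (Sn (unit_fun u))))"
      by (rule eventually_finite_subsets_at_top_weakI)
    then show ?thesis
      using limitin_shift_funpow_truncate[OF f order.refl] val[OF f]
      by (simp add: limitin_transform_eventually)
  qed
  moreover have "((\<lambda>u. (cmod (f u))\<^sup>2 * (ell2_norm V (the (Sn (unit_fun u))))\<^sup>2)
      has_sum (ell2_norm V (the (Sn f)))\<^sup>2) {u \<in> V. f u \<noteq> 0}" if f: "f \<in> ?D" for f
    using has_sum_shift_funpow_norm[OF f order.refl] unfolding val[OF f]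
    by (rule has_sum_cong[THEN iffD1, rotated]) (simp add: val unit[OF f])
  moreover have "pairwise (\<lambda>u u'. ell2_inner V (cscale (f u) (the (Sn (unit_fun u))))
      (cscale (f u') (the (Sn (unit_fun u')))) = 0) {u \<in> V. f u \<noteq> 0}" if f: "f \<in> ?D" for f
    by (auto simp: pairwise_def val unit[OF f] shift_funpow_unit_fun_orthogonal)
  ultimately show ?thesis
    unfolding dom
    using shift_domain_iff[of _ lam n] unit is_core_unit_span[of lam n] densely_defined_iff[of lam n]
    by (simp add: generation_mass_def Sn_def)
qed

end
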